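(* Let $\mathbf{H}\in\mathbb{R}^{d\times d}$ be a symmetric positive semidefinite matrix with exactly $r$ distinct eigenvalues $\lambda_1>\lambda_2>\dots>\lambda_r$, and let $m\ge1$ be an integer. Then for any $\mathbf{g}\in\mathbb{R}^d$: $\rho^{(m)}(\mathbf{H},\mathbf{g})\le\big(\prod_{i=1}^m\lambda_i\big)^{1/m}$ if $m<r$, and $\rho^{(m)}(\mathbf{H},\mathbf{g})=0$ if $m\ge r$.
   Context: For a symmetric matrix $\mathbf{A}\in\mathbb{R}^{d\times d}$ and $\mathbf{b}\in\mathbb{R}^d$, let $\mathcal{K}_j(\mathbf{A},\mathbf{b})=\mathrm{span}\{\mathbf{b},\mathbf{A}\mathbf{b},\dots,\mathbf{A}^{j-1}\mathbf{b}\}$ (Krylov subspace). For $j\ge1$ define $$\sigma^{(j)}(\mathbf{A},\mathbf{b})=\max_{\mathbf{w}\in\mathcal{K}_j(\mathbf{A},\mathbf{b}),\ \|\mathbf{w}\|=1}\mathrm{dist}\big(\mathbf{A}\mathbf{w},\mathcal{K}_j(\mathbf{A},\mathbf{b})\big),\qquad \mathrm{dist}(\mathbf{u},\mathcal{V})=\min_{\mathbf{v}\in\mathcal{V}}\|\mathbf{u}-\mathbf{v}\|$$ (Euclidean norm), and $\rho^{(m)}(\mathbf{A},\mathbf{b})=\big(\prod_{j=1}^m\sigma^{(j)}(\mathbf{A},\mathbf{b})\big)^{1/m}$. Convention: if $\mathbf{b}=0$ then $\sigma^{(j)}(\mathbf{A},\mathbf{b})=0$. *)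

theory Defs
  imports "HOL-Analysis.Analysis"
begin

definition psd :: "real^'d^'d \<Rightarrow> bool" where
  "psd A \<longleftrightarrow> transpose A = A \<and> (\<forall>x. 0 \<le> x \<bullet> (A *v x))"

definition eigenval :: "real^'d^'d \<Rightarrow> real \<Rightarrow> bool" where
  "eigenval A c \<longleftrightarrow> (\<exists>v. v \<noteq> 0 \<and> A *v v = c *\<^sub>R v)"

definition krylov :: "nat \<Rightarrow> real^'d^'d \<Rightarrow> real^'d \<Rightarrow> (real^'d) set" where
  "krylov j A b = span ((\<lambda>i. (((*v) A) ^^ i) b) ` {..<j})"

text \<open>
  The inner minimum is \<open>infdist\<close> and the outer maximum is a supremum; lemmas
  \<open>krylov_infdist_attained\<close> and \<open>krylov_sigma_attained\<close> below show that both are attained.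
  For \<open>b = 0\<close> the supremum would range over the empty set; the value 0 is then a convention.
  For \<open>j = 0\<close> the value is meaningless; it is never used.
\<close>

definition krylov_sigma :: "nat \<Rightarrow> real^'d^'d \<Rightarrow> real^'d \<Rightarrow> real" where
  "krylov_sigma j A b =
     (if b = 0 then 0
      else (SUP w \<in> {w \<in> krylov j A b. norm w = 1}. infdist (A *v w) (krylov j A b)))"

definition krylov_rho :: "nat \<Rightarrow> real^'d^'d \<Rightarrow> real^'d \<Rightarrow> real" where
  "krylov_rho m A b = root m (\<Prod>j=1..m. krylov_sigma j A b)"

lemma krylov_infdist_attained:
  "\<exists>v \<in> krylov j A b. infdist u (krylov j A b) = norm (u - v)
     \<and> (\<forall>v' \<in> krylov j A b. norm (u - v) \<le> norm (u - v'))"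
proof -
  have cl: "closed (krylov j A b)"
    unfolding krylov_def by (rule closed_span)
  have ne: "krylov j A b \<noteq> {}"
    unfolding krylov_def using span_zero by blast
  obtain v where v: "v \<in> krylov j A b" "infdist u (krylov j A b) = dist u v"
    using infdist_attains_inf[OF cl ne] by blast
  moreover have "dist u v \<le> dist u v'" if "v' \<in> krylov j A b" for v'
    using infdist_le[OF that, of u] v(2) by simp
  ultimately show ?thesis
    by (auto simp: dist_norm)
qed

lemma krylov_sigma_attained:
  assumes "b \<noteq> 0" "j \<ge> 1"
  shows "\<exists>w \<in> krylov j A b. norm w = 1
     \<and> krylov_sigma j A b = infdist (A *v w) (krylov j A b)
     \<and> (\<forall>w' \<in> krylov j A b. norm w' = 1 \<longrightarrow>
          infdist (A *v w') (krylov j A b) \<le> infdist (A *v w) (krylov j A b))"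
proof -
  let ?K = "krylov j A b" and ?S = "{w \<in> krylov j A b. norm w = 1}"
  let ?f = "\<lambda>w. infdist (A *v w) (krylov j A b)"
  have "((\<lambda>i. (((*v) A) ^^ i) b) 0) \<in> (\<lambda>i. (((*v) A) ^^ i) b) ` {..<j}"
    by (rule imageI) (use assms in simp)
  then have "b \<in> ?K"
    unfolding krylov_def by (auto intro: span_base)
  then have "(1 / norm b) *\<^sub>R b \<in> ?S"
    using assms by (simp add: krylov_def span_scale)
  then have ne: "?S \<noteq> {}" by blast
  have "?S = ?K \<inter> sphere 0 1" by auto
  then have co: "compact ?S"
    by (simp add: krylov_def closed_Int_compact)
  have cont: "continuous_on ?S ?f"
    by (intro continuous_on_infdist linear_continuous_on matrix_vector_mul_bounded_linear)
  obtain w where w: "w \<in> ?S" "\<And>w'. w' \<in> ?S \<Longrightarrow> ?f w' \<le> ?f w"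
    using continuous_attains_sup[OF co ne cont] by blast
  have "(SUP w' \<in> ?S. ?f w') = ?f w"
    by (rule cSup_eq_maximum) (use w in auto)
  then show ?thesis
    using w assms by (auto simp: krylov_sigma_def intro!: bexI[of _ w])
qed

end

theory Submission
  imports Defs
begin

text \<open>
  Let \<open>D\<^sub>j\<close> be the distance from \<open>A\<^sup>j g\<close> to the Krylov space \<open>K\<^sub>j\<close>. A unit vector of \<open>K\<^sub>j\<close> is
  \<open>c A\<^sup>j\<^sup>-\<^sup>1 g + u\<close> with \<open>u \<in> K\<^sub>j\<^sub>-\<^sub>1\<close>, so its distance 1 from the origin bounds \<open>\<bar>c\<bar> D\<^sub>j\<^sub>-\<^sub>1\<close>, while its image
  lies at distance \<open>\<bar>c\<bar> D\<^sub>j\<close> from \<open>K\<^sub>j\<close>. Hence \<open>\<sigma>\<^sub>j D\<^sub>j\<^sub>-\<^sub>1 \<le> D\<^sub>j\<close>, and the product of the first \<open>m\<close> values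
  telescopes to at most \<open>D\<^sub>m / D\<^sub>0\<close>. Finally \<open>D\<^sub>m\<close> is at most the norm of \<open>p(H) g\<close> for the monic
  polynomial \<open>p\<close> with roots \<open>\<lambda>\<^sub>1, \<dots>, \<lambda>\<^sub>m\<close>: it vanishes at these eigenvalues and is at most their product in
  absolute value at the smaller ones, all of them being nonnegative.
\<close>

section \<open>Spectral decomposition of a symmetric matrix\<close>

lemma symmetric_matrix_inner:
  fixes A :: "real^'n^'n"
  assumes "transpose A = A"
  shows "(A *v x) \<bullet> y = x \<bullet> (A *v y)"
  by (metis assms dot_lmul_matrix transpose_matrix_vector)

lemma eigenvectors_orthogonal:
  fixes A :: "real^'n^'n"
  assumes "transpose A = A" "A *v v = a *\<^sub>R v" "A *v w = b *\<^sub>R w" "a \<noteq> b"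
  shows "v \<bullet> w = 0"
  using symmetric_matrix_inner[OF assms(1), of v w] assms(2-4) by simp

lemma eigenval_nonneg:
  assumes "psd A" "eigenval A c"
  shows "0 \<le> c"
proof -
  obtain v where v: "v \<noteq> 0" "A *v v = c *\<^sub>R v"
    using assms(2) by (auto simp: eigenval_def)
  have "0 \<le> v \<bullet> (A *v v)"
    using assms(1) by (simp add: psd_def)
  then have "0 \<le> c * (v \<bullet> v)"
    by (simp add: v(2))
  moreover have "0 < v \<bullet> v"
    using v(1) by simp
  ultimately show ?thesis
    unfolding zero_le_mult_iff by linarith
qed

text \<open>The maximiser of the Rayleigh quotient on the invariant subspace is an eigenvector.\<close>

lemma symmetric_invariant_subspace_eigenvector:
  fixes A :: "real^'n^'n"
  assumes sym: "transpose A = A" and W: "subspace W" "W \<noteq> {0}"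
    and inv: "\<And>x. x \<in> W \<Longrightarrow> A *v x \<in> W"
  obtains c x where "x \<in> W" "x \<noteq> 0" "A *v x = c *\<^sub>R x"
proof -
  let ?S = "W \<inter> sphere 0 1"
  obtain w where w: "w \<in> W" "w \<noteq> 0"
    using W subspace_0 by blast
  then have "(1 / norm w) *\<^sub>R w \<in> ?S"
    using W(1) by (simp add: subspace_scale)
  then have ne: "?S \<noteq> {}" by blast
  have co: "compact ?S"
    by (intro closed_Int_compact closed_subspace W) simp
  have cont: "continuous_on ?S (\<lambda>x. x \<bullet> (A *v x))"
    by (intro continuous_intros linear_continuous_on matrix_vector_mul_bounded_linear)
  obtain x where x: "x \<in> ?S" and xmax: "\<And>y. y \<in> ?S \<Longrightarrow> y \<bullet> (A *v y) \<le> x \<bullet> (A *v x)"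
    using continuous_attains_sup[OF co ne cont] by blast
  define c where "c = x \<bullet> (A *v x)"
  \<comment> \<open>By maximality of \<open>c\<close>, the form of \<open>B = c I - A\<close> is
    nonnegative on \<open>W\<close>; it vanishes at \<open>x\<close>. It remains to deduce
    \<open>B x = 0\<close>.\<close>
  define B where "B = (\<lambda>y. c *\<^sub>R y - A *v y)"
  have Blin: "B (u + t *\<^sub>R v) = B u + t *\<^sub>R B v" for u v t
    by (simp add: B_def matrix_vector_right_distrib matrix_vector_mult_scaleR algebra_simps)
  have Bsym: "B u \<bullet> v = u \<bullet> B v" for u v
    by (simp add: B_def inner_diff symmetric_matrix_inner[OF sym])
  have BW: "B y \<in> W" if "y \<in> W" for y
    using that W(1) inv by (simp add: B_def subspace_diff subspace_scale)
  have Bpos: "0 \<le> y \<bullet> B y" if "y \<in> W" for y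
  proof (cases "y = 0")
    case False
    let ?u = "(1 / norm y) *\<^sub>R y"
    have "?u \<in> ?S"
      using False that W(1) by (simp add: subspace_scale)
    from xmax[OF this] have "y \<bullet> (A *v y) / (norm y)\<^sup>2 \<le> c"
      by (simp add: c_def matrix_vector_mult_scaleR power2_eq_square)
    then have "y \<bullet> (A *v y) \<le> c * (norm y)\<^sup>2"
      using False by (simp add: divide_le_eq)
    then show ?thesis
      by (simp add: B_def inner_diff power2_norm_eq_inner)
  qed simp
  have x1: "x \<in> W" "x \<bullet> x = 1"
    using x by (auto simp: norm_eq_1)
  have xB: "x \<bullet> B x = 0"
    by (simp add: B_def inner_diff x1 c_def)
  define y where "y = B x"
  have yW: "y \<in> W"
    unfolding y_def by (rule BW[OF x1(1)])
  \<comment> \<open>Moving from \<open>x\<close> in the direction \<open>y = B x\<close> keeps the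
    form nonnegative; by symmetry of \<open>B\<close> both cross terms equal
    \<open>y \<bullet> y\<close>.\<close>
  have quad: "0 \<le> 2 * t * (y \<bullet> y) + t\<^sup>2 * (y \<bullet> B y)" for t
  proof -
    have "0 \<le> (x + t *\<^sub>R y) \<bullet> B (x + t *\<^sub>R y)"
      by (intro Bpos subspace_add subspace_scale W x1 yW)
    also have "\<dots> = 2 * t * (y \<bullet> y) + t\<^sup>2 * (y \<bullet> B y)"
      using Bsym[of x y] xB
      by (simp add: Blin inner_add power2_eq_square algebra_simps flip: y_def)
    finally show ?thesis .
  qed
  have "y \<bullet> y = 0"
  proof (rule ccontr)
    assume "y \<bullet> y \<noteq> 0"
    then have yy: "0 < y \<bullet> y"
      by simp
    show False
    \<comment> \<open>A bound linear in \<open>t\<close> fails at \<open>t = -1\<close>; a genuine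
      quadratic is negative at its minimiser
      \<open>t = - (y \<bullet> y) / (y \<bullet> B y)\<close>.\<close>
    proof (cases "y \<bullet> B y = 0")
      case True
      then show False using quad[of "-1"] yy by simp
    next
      case False
      then have q: "0 < y \<bullet> B y"
        using Bpos[OF yW] by simp
      have "2 * (- (y \<bullet> y) / (y \<bullet> B y)) * (y \<bullet> y) + (- (y \<bullet> y) / (y \<bullet> B y))\<^sup>2 * (y \<bullet> B y)
          = - ((y \<bullet> y)\<^sup>2 / (y \<bullet> B y))"
        using q by (simp add: field_simps power2_eq_square)
      with quad[of "- (y \<bullet> y) / (y \<bullet> B y)"] have "(y \<bullet> y)\<^sup>2 / (y \<bullet> B y) \<le> 0"
        by linarith
      moreover have "0 < (y \<bullet> y)\<^sup>2 / (y \<bullet> B y)"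
        using yy q by simp
      ultimately show False by linarith
    qed
  qed
  then have "A *v x = c *\<^sub>R x"
    by (simp add: y_def B_def)
  moreover have "x \<noteq> 0"
    using x1 by auto
  ultimately show ?thesis
    using that x1 by blast
qed

text \<open>The orthogonal complement of all eigenvectors is invariant under \<open>A\<close>. Were
  it nonzero, it would contain an eigenvector, which would be orthogonal to itself.\<close>

lemma span_eigenvectors_symmetric:
  fixes A :: "real^'n^'n"
  assumes sym: "transpose A = A"
  shows "span {v. \<exists>c. A *v v = c *\<^sub>R v} = UNIV"
proof -
  let ?E = "{v. \<exists>c. A *v v = c *\<^sub>R v}"
  define W where "W = {x. \<forall>v\<in>?E. v \<bullet> x = 0}"
  have "subspace W"
    by (auto simp: W_def subspace_def inner_add)
  moreover have "A *v x \<in> W" if "x \<in> W" for x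
    using that by (auto simp: W_def simp flip: symmetric_matrix_inner[OF sym])
  ultimately have W0: "W = {0}"
  proof (rule_tac ccontr)
    assume *: "subspace W" "\<And>x. x \<in> W \<Longrightarrow> A *v x \<in> W" "W \<noteq> {0}"
    then obtain c x where x: "x \<in> W" "x \<noteq> 0" "A *v x = c *\<^sub>R x"
      using symmetric_invariant_subspace_eigenvector[OF sym] by metis
    then have "x \<bullet> x = 0"
      unfolding W_def by blast
    with x show False by simp
  qed
  have "x \<in> span ?E" for x
  proof -
    obtain y z where yz: "y \<in> span ?E" "\<And>w. w \<in> span ?E \<Longrightarrow> orthogonal z w" "x = y + z"
      using orthogonal_subspace_decomp_exists by blast
    then have "z \<in> W"
      by (auto simp: W_def orthogonal_def inner_commute intro: span_base)
    then show ?thesis using W0 yz by simp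
  qed
  then show ?thesis by blast
qed

text \<open>A combination of eigenvectors is grouped by eigenvalue, one summand at a time.
  Components \<open>v k\<close> may be zero.\<close>

lemma symmetric_eigen_decomposition:
  fixes A :: "real^'n^'n"
  assumes sym: "transpose A = A"
    and I: "finite I" "{c. eigenval A c} = lam ` I"
  obtains v where "x = (\<Sum>k\<in>I. v k)" "\<And>k. k \<in> I \<Longrightarrow> A *v v k = lam k *\<^sub>R v k"
proof -
  let ?V = "{x. \<exists>v. x = (\<Sum>k\<in>I. v k) \<and> (\<forall>k\<in>I. A *v v k = lam k *\<^sub>R v k)}"
  have "x \<in> span {v. \<exists>c. A *v v = c *\<^sub>R v}"
    by (simp add: span_eigenvectors_symmetric[OF sym])
  then have "x \<in> ?V"
  proof (rule span_induct_alt, goal_cases)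
    case 1
    then show ?case by (auto intro!: exI[of _ "\<lambda>_. 0"])
  next
    case (2 t e y)
    then obtain c v where c: "A *v e = c *\<^sub>R e"
      and v: "y = (\<Sum>k\<in>I. v k)" "\<forall>k\<in>I. A *v v k = lam k *\<^sub>R v k"
      by blast
    show ?case
    \<comment> \<open>The zero vector satisfies the eigenvector equation for every \<open>c\<close>,
      so only a nonzero \<open>e\<close> yields an index \<open>l\<close>.\<close>
    proof (cases "e = 0")
      case True
      then show ?thesis using 2 by simp
    next
      case False
      then obtain l where l: "l \<in> I" "c = lam l"
        using c I(2) by (auto simp: eigenval_def)
      let ?v = "v(l := t *\<^sub>R e + v l)"
      have "(\<Sum>k\<in>I. ?v k) = (\<Sum>k\<in>I. (if k = l then t *\<^sub>R e else 0) + v k)"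
        by (intro sum.cong) auto
      also have "\<dots> = t *\<^sub>R e + y"
        using l I(1) by (simp add: sum.distrib v)
      finally have "t *\<^sub>R e + y = (\<Sum>k\<in>I. ?v k)" ..
      moreover have "\<forall>k\<in>I. A *v ?v k = lam k *\<^sub>R ?v k"
        using v(2) c l
        by (simp add: matrix_vector_right_distrib matrix_vector_mult_scaleR algebra_simps)
      ultimately show ?thesis by blast
    qed
  qed
  then show ?thesis using that by blast
qed

section \<open>Orthogonal sums and distances to a subspace\<close>

lemma norm_sum_scaleR_orthogonal_le:
  fixes v :: "'i \<Rightarrow> 'a::real_inner"
  assumes I: "finite I" and orth: "\<And>i j. i \<in> I \<Longrightarrow> j \<in> I \<Longrightarrow> i \<noteq> j \<Longrightarrow> v i \<bullet> v j = 0"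
    and a: "\<And>i. i \<in> I \<Longrightarrow> \<bar>a i\<bar> \<le> C" and C: "0 \<le> C"
  shows "norm (\<Sum>i\<in>I. a i *\<^sub>R v i) \<le> C * norm (\<Sum>i\<in>I. v i)"
proof (rule power2_le_imp_le)
  have "(norm (\<Sum>i\<in>I. a i *\<^sub>R v i))\<^sup>2 = (\<Sum>i\<in>I. (norm (a i *\<^sub>R v i))\<^sup>2)"
    by (intro norm_sum_Pythagorean I) (auto simp: pairwise_def orthogonal_def orth)
  also have "\<dots> \<le> (\<Sum>i\<in>I. C\<^sup>2 * (norm (v i))\<^sup>2)"
  proof (rule sum_mono)
    fix i assume "i \<in> I"
    then have "(a i)\<^sup>2 \<le> C\<^sup>2"
      using power_mono[OF a, of i 2] by simp
    then show "(norm (a i *\<^sub>R v i))\<^sup>2 \<le> C\<^sup>2 * (norm (v i))\<^sup>2"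
      by (simp add: power_mult_distrib mult_right_mono)
  qed
  also have "\<dots> = C\<^sup>2 * (norm (\<Sum>i\<in>I. v i))\<^sup>2"
    by (subst norm_sum_Pythagorean[OF I])
      (auto simp: pairwise_def orthogonal_def orth sum_distrib_left)
  finally show "(norm (\<Sum>i\<in>I. a i *\<^sub>R v i))\<^sup>2 \<le> (C * norm (\<Sum>i\<in>I. v i))\<^sup>2"
    by (simp add: power_mult_distrib)
qed (simp add: C)

text \<open>If \<open>v\<close> is the point of \<open>V\<close> nearest to \<open>x\<close>, then
  \<open>c *\<^sub>R v + u\<close> is a candidate for the left-hand side.\<close>

lemma infdist_subspace_scaleR_add_le:
  fixes V :: "'a::euclidean_space set"
  assumes V: "subspace V" and u: "u \<in> V"
  shows "infdist (c *\<^sub>R x + u) V \<le> \<bar>c\<bar> * infdist x V"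
proof -
  obtain v where v: "v \<in> V" "infdist x V = dist x v"
    using infdist_attains_inf[OF closed_subspace[OF V]] subspace_0[OF V] by blast
  have "infdist (c *\<^sub>R x + u) V \<le> dist (c *\<^sub>R x + u) (c *\<^sub>R v + u)"
    by (intro infdist_le subspace_add subspace_scale V u v)
  also have "\<dots> = \<bar>c\<bar> * infdist x V"
    by (simp add: v dist_norm flip: scaleR_diff_right)
  finally show ?thesis .
qed

lemma infdist_subspace_scaleR_add:
  fixes V :: "'a::euclidean_space set"
  assumes V: "subspace V" and u: "u \<in> V"
  shows "infdist (c *\<^sub>R x + u) V = \<bar>c\<bar> * infdist x V"
proof (rule antisym[OF infdist_subspace_scaleR_add_le[OF V u]])
  show "\<bar>c\<bar> * infdist x V \<le> infdist (c *\<^sub>R x + u) V"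
  proof (cases "c = 0")
    case False
    \<comment> \<open>Undoing the affine map turns the previous inequality, used with
      \<open>inverse c\<close>, into its converse.\<close>
    have "x = inverse c *\<^sub>R (c *\<^sub>R x + u) + (- inverse c *\<^sub>R u)"
      using False by (simp add: algebra_simps)
    moreover have "- inverse c *\<^sub>R u \<in> V"
      by (intro subspace_scale V u)
    ultimately have "infdist x V \<le> \<bar>inverse c\<bar> * infdist (c *\<^sub>R x + u) V"
      using infdist_subspace_scaleR_add_le[OF V] by metis
    then show ?thesis
      using False by (simp add: field_simps)
  qed (simp add: infdist_nonneg)
qed

section \<open>Krylov subspaces: telescoping distances and monic polynomials\<close>

lemma subspace_krylov: "subspace (krylov j A b)"
  by (simp add: krylov_def)

lemma krylov_0: "krylov 0 A b = {0}"
  by (simp add: krylov_def)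

lemma funpow_in_krylov: "i < j \<Longrightarrow> (((*v) A) ^^ i) b \<in> krylov j A b"
  unfolding krylov_def by (intro span_base) auto

lemma krylov_Suc_mono: "x \<in> krylov j A b \<Longrightarrow> x \<in> krylov (Suc j) A b"
  unfolding krylov_def by (rule subsetD[OF span_mono]) auto

lemma krylov_matrix_mult: "x \<in> krylov j A b \<Longrightarrow> A *v x \<in> krylov (Suc j) A b"
  unfolding krylov_def[of j]
proof (induction rule: span_induct_alt)
  case base
  show ?case by (simp add: subspace_0 subspace_krylov)
next
  case (step c x y)
  then obtain i where i: "i < j" "x = (((*v) A) ^^ i) b"
    by auto
  have "A *v x \<in> krylov (Suc j) A b"
    using i funpow_in_krylov[of "Suc i" "Suc j" A b] by simp
  with step show ?case
    by (simp add: matrix_vector_right_distrib matrix_vector_mult_scaleR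
        subspace_add subspace_scale subspace_krylov)
qed

lemma krylov_Suc_decomp:
  assumes "x \<in> krylov (Suc j) A b"
  obtains c u where "u \<in> krylov j A b" "x = c *\<^sub>R (((*v) A) ^^ j) b + u"
proof -
  obtain c where "x - c *\<^sub>R (((*v) A) ^^ j) b \<in> krylov j A b"
    using assms by (auto simp: krylov_def lessThan_Suc span_insert)
  then show ?thesis
    using that[of "x - c *\<^sub>R (((*v) A) ^^ j) b" c] by simp
qed

lemma krylov_sigma_Suc_mult_le:
  "krylov_sigma (Suc j) A b * infdist ((((*v) A) ^^ j) b) (krylov j A b)
     \<le> infdist ((((*v) A) ^^ Suc j) b) (krylov (Suc j) A b)"
proof (cases "b = 0")
  case False
  let ?D = "\<lambda>j. infdist ((((*v) A) ^^ j) b) (krylov j A b)"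
  obtain w where w: "w \<in> krylov (Suc j) A b" "norm w = 1"
    "krylov_sigma (Suc j) A b = infdist (A *v w) (krylov (Suc j) A b)"
    using krylov_sigma_attained[OF False, of "Suc j" A] by auto
  obtain c u where u: "u \<in> krylov j A b" "w = c *\<^sub>R (((*v) A) ^^ j) b + u"
    using krylov_Suc_decomp[OF w(1)] .
  have "infdist w (krylov j A b) \<le> dist w 0"
    by (intro infdist_le subspace_0 subspace_krylov)
  then have c: "\<bar>c\<bar> * ?D j \<le> 1"
    by (simp add: w u(2)[symmetric] flip: infdist_subspace_scaleR_add[OF subspace_krylov u(1)])
  \<comment> \<open>Since \<open>A *v u\<close> lies in the enlarged Krylov space, only the leading
    coefficient \<open>c\<close> affects the distance.\<close>
  have "A *v w = c *\<^sub>R (((*v) A) ^^ Suc j) b + A *v u"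
    by (simp add: u matrix_vector_right_distrib matrix_vector_mult_scaleR)
  then have "krylov_sigma (Suc j) A b = \<bar>c\<bar> * ?D (Suc j)"
    using w(3) infdist_subspace_scaleR_add[OF subspace_krylov krylov_matrix_mult[OF u(1)]]
    by metis
  then show ?thesis
    using mult_right_mono[OF c infdist_nonneg[of "(((*v) A) ^^ Suc j) b" "krylov (Suc j) A b"]]
    by (simp add: algebra_simps)
qed (simp add: krylov_sigma_def infdist_nonneg)

lemma krylov_sigma_nonneg: "j \<ge> 1 \<Longrightarrow> 0 \<le> krylov_sigma j A b"
  using krylov_sigma_attained[of b j A] infdist_nonneg
  by (cases "b = 0") (auto simp: krylov_sigma_def)

text \<open>Telescoping by induction; the factor \<open>norm b\<close> is the initial distance, from
  \<open>b\<close> to the zero space \<open>krylov 0 A b\<close>.\<close>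

lemma prod_krylov_sigma_le:
  "(\<Prod>j=1..m. krylov_sigma j A b) * norm b \<le> infdist ((((*v) A) ^^ m) b) (krylov m A b)"
proof (induction m)
  case 0
  then show ?case by (simp add: krylov_0)
next
  case (Suc m)
  have "(\<Prod>j=1..Suc m. krylov_sigma j A b) * norm b
      = krylov_sigma (Suc m) A b * ((\<Prod>j=1..m. krylov_sigma j A b) * norm b)"
    by simp
  also have "\<dots> \<le> krylov_sigma (Suc m) A b * infdist ((((*v) A) ^^ m) b) (krylov m A b)"
    by (intro mult_left_mono Suc krylov_sigma_nonneg) simp
  also have "\<dots> \<le> infdist ((((*v) A) ^^ Suc m) b) (krylov (Suc m) A b)"
    by (rule krylov_sigma_Suc_mult_le)
  finally show ?case .
qed

text \<open>The sum below is \<open>p(A) b\<close> for the monic polynomial \<open>p\<close> with roots \<open>c 1, \<dots>, c n\<close>.\<close>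

lemma funpow_diff_monic_in_krylov:
  assumes b: "b = (\<Sum>k\<in>I. v k)" and v: "\<And>k. k \<in> I \<Longrightarrow> A *v v k = lam k *\<^sub>R v k"
  shows "(((*v) A) ^^ n) b - (\<Sum>k\<in>I. (\<Prod>i=1..n. lam k - c i) *\<^sub>R v k) \<in> krylov n A b"
proof (induction n)
  case 0
  then show ?case by (simp add: b krylov_0)
next
  case (Suc n)
  let ?x = "(((*v) A) ^^ n) b"
  let ?P = "\<lambda>n. \<Sum>k\<in>I. (\<Prod>i=1..n. lam k - c i) *\<^sub>R v k"
  have "A *v ?P n = (\<Sum>k\<in>I. (\<Prod>i=1..n. lam k - c i) *\<^sub>R lam k *\<^sub>R v k)"
    by (subst linear_sum[OF matrix_vector_mul_linear], intro sum.cong refl)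
      (simp add: matrix_vector_mult_scaleR v)
  \<comment> \<open>The new root contributes the factor \<open>A - c (Suc n) I\<close>, acting on
    the eigenvector \<open>v k\<close> as \<open>lam k - c (Suc n)\<close>.\<close>
  then have "?P (Suc n) = A *v ?P n - c (Suc n) *\<^sub>R ?P n"
    by (simp add: scaleR_sum_right sum_subtractf[symmetric] algebra_simps)
  \<comment> \<open>Writing \<open>?P n\<close> as \<open>?x - (?x - ?P n)\<close> lets the
    induction hypothesis place both summands in the next Krylov space.\<close>
  then have "(((*v) A) ^^ Suc n) b - ?P (Suc n)
      = A *v (?x - ?P n) + c (Suc n) *\<^sub>R (?x - (?x - ?P n))"
    by (simp add: matrix_vector_mult_diff_distrib)
  also have "\<dots> \<in> krylov (Suc n) A b"
    by (intro subspace_add subspace_scale subspace_diff subspace_krylov krylov_matrix_mult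
        krylov_Suc_mono[OF Suc] Suc funpow_in_krylov) simp
  finally show ?case .
qed

text \<open>Subtracting \<open>p(A) b\<close> for a monic \<open>p\<close> of degree
  \<open>n\<close> from the \<open>n\<close>-th power vector gives a competitor in the Krylov space.
  As \<open>lam\<close> is injective, the eigencomponents of \<open>b\<close> are orthogonal, so
  \<open>p(A)\<close> stretches \<open>b\<close> at most by \<open>C\<close>.\<close>

lemma infdist_funpow_krylov_le:
  fixes A :: "real^'n^'n"
  assumes sym: "transpose A = A" and I: "finite I" "{c. eigenval A c} = lam ` I" "inj_on lam I"
    and C: "\<And>k. k \<in> I \<Longrightarrow> \<bar>\<Prod>i=1..n. lam k - c i\<bar> \<le> C" "0 \<le> C"
  shows "infdist ((((*v) A) ^^ n) b) (krylov n A b) \<le> C * norm b"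
proof -
  obtain v where b: "b = (\<Sum>k\<in>I. v k)" and v: "\<And>k. k \<in> I \<Longrightarrow> A *v v k = lam k *\<^sub>R v k"
    using symmetric_eigen_decomposition[OF sym I(1,2), of b] by metis
  let ?x = "(((*v) A) ^^ n) b" and ?P = "\<Sum>k\<in>I. (\<Prod>i=1..n. lam k - c i) *\<^sub>R v k"
  have "infdist ?x (krylov n A b) \<le> dist ?x (?x - ?P)"
    by (intro infdist_le funpow_diff_monic_in_krylov b v)
  also have "\<dots> = norm ?P"
    by (simp add: dist_norm)
  also have "\<dots> \<le> C * norm b"
    unfolding b
  proof (rule norm_sum_scaleR_orthogonal_le[OF I(1) _ C])
    show "v k \<bullet> v l = 0" if "k \<in> I" "l \<in> I" "k \<noteq> l" for k l
      using eigenvectors_orthogonal[OF sym v v] that I(3) by (auto dest: inj_onD)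
  qed
  finally show ?thesis .
qed

theorem lemma4p7:
  fixes H :: "real^'d^'d" and g :: "real^'d"
    and r m :: nat and lam :: "nat \<Rightarrow> real"
  assumes "psd H"
    and "{c. eigenval H c} = lam ` {1..r}"
    and "\<forall>i\<in>{1..r}. \<forall>j\<in>{1..r}. i < j \<longrightarrow> lam i > lam j"
    and "m \<ge> 1"
  shows "(m < r \<longrightarrow> krylov_rho m H g \<le> root m (\<Prod>i=1..m. lam i))
       \<and> (m \<ge> r \<longrightarrow> krylov_rho m H g = 0)"
proof -
  have sym: "transpose H = H"
    using assms(1) by (simp add: psd_def)
  have inj: "inj_on lam {1..r}"
    using assms(3) by (intro linorder_inj_onI) (auto, fastforce)
  have nn: "0 \<le> lam i" if "i \<in> {1..r}" for i
    using eigenval_nonneg[OF assms(1)] assms(2) that by blast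
  let ?s = "\<lambda>j. krylov_sigma j H g"
  \<comment> \<open>The roots are chosen as the \<open>n\<close> largest eigenvalues when
    \<open>n \<le> r\<close>; \<open>norm g\<close> cancels once
    \<open>g \<noteq> 0\<close>.\<close>
  have bound: "(\<Prod>j=1..n. ?s j) * norm g \<le> C * norm g"
    if "\<And>k. k \<in> {1..r} \<Longrightarrow> \<bar>\<Prod>i=1..n. lam k - lam i\<bar> \<le> C" "0 \<le> C" for n C
    using prod_krylov_sigma_le[of H g n]
      infdist_funpow_krylov_le[OF sym finite_atLeastAtMost assms(2) inj that] by (rule order_trans)
  show ?thesis
  proof (cases "g = 0")
    case True
    then have "krylov_rho m H g = 0"
      using assms(4) by (simp add: krylov_rho_def krylov_sigma_def)
    moreover have "0 \<le> root m (\<Prod>i=1..m. lam i)" if "m < r"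
      using that by (intro real_root_ge_zero prod_nonneg nn) auto
    ultimately show ?thesis by simp
  next
    case False
    have "krylov_rho m H g \<le> root m (\<Prod>i=1..m. lam i)" if "m < r"
    proof -
      have "\<bar>\<Prod>i=1..m. lam k - lam i\<bar> \<le> (\<Prod>i=1..m. lam i)" if k: "k \<in> {1..r}" for k
      proof (cases "k \<le> m")
        case True
        then have "(\<Prod>i=1..m. lam k - lam i) = 0"
          using k by (intro prod_zero) auto
        moreover have "0 \<le> (\<Prod>i=1..m. lam i)"
          using \<open>m < r\<close> by (intro prod_nonneg nn) auto
        ultimately show ?thesis by (simp only: abs_zero)
      next
        case False
        \<comment> \<open>Here \<open>i \<le> m < k\<close>, hence
          \<open>0 \<le> lam k < lam i\<close>.\<close>
        have "\<bar>lam k - lam i\<bar> \<le> lam i" if "i \<in> {1..m}" for i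
        proof -
          have "lam k < lam i" "0 \<le> lam k"
            using assms(3) nn that k False by auto
          then show ?thesis by simp
        qed
        then show ?thesis
          unfolding abs_prod by (intro prod_mono) auto
      qed
      moreover have "0 \<le> (\<Prod>i=1..m. lam i)"
        using that by (intro prod_nonneg nn) auto
      ultimately have "(\<Prod>j=1..m. ?s j) \<le> (\<Prod>i=1..m. lam i)"
        using bound[of m "\<Prod>i=1..m. lam i"] False by simp
      then show ?thesis
        using assms(4) by (simp add: krylov_rho_def)
    qed
    moreover have "krylov_rho m H g = 0" if "r \<le> m"
    proof -
      \<comment> \<open>With \<open>r\<close> roots the polynomial annihilates every eigencomponent,
        so \<open>C = 0\<close> is admissible.\<close>
      have "(\<Prod>i=1..r. lam k - lam i) = 0" if "k \<in> {1..r}" for k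
        using that by (intro prod_zero) auto
      then have "(\<Prod>j=1..r. ?s j) \<le> 0"
        using bound[of r 0] False by (simp add: mult_le_0_iff)
      moreover have "0 \<le> (\<Prod>j=1..r. ?s j)"
        by (intro prod_nonneg krylov_sigma_nonneg) auto
      ultimately have "(\<Prod>j=1..r. ?s j) = 0"
        by simp
      \<comment> \<open>A vanishing factor with index at most \<open>r\<close> also occurs in the
        product up to \<open>m\<close>.\<close>
      then obtain j where "j \<in> {1..r}" "?s j = 0"
        by (auto simp: prod_zero_iff)
      then have "(\<Prod>j=1..m. ?s j) = 0"
        using that by (intro prod_zero) auto
      then show ?thesis
        by (simp only: krylov_rho_def real_root_zero)
    qed
    ultimately show ?thesis by blast
  qed
qed

end
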